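(* Let $I=(S,\{t\},C,\alpha)$ be a feasible source-equally-spaced circular instance of FLaMECaST with one intermediate layer and one sink $t$. Then for every linear ordering of $S$ obtained from the cyclic (counterclockwise) order of the sources along the circle by choosing a starting source, there is a valid layout of minimum cost that is $1$-consecutive with respect to this linear ordering.
   Context: FLaMECaST: an instance $I=(S,T,C,\alpha)$ consists of a finite set $S$ of sources and a finite set $T$ of sinks, each with a fixed position in $\mathbb{R}^2$, capacities $C=(c_0,\dots,c_{\lambda+1})$ with integers $c_0\ge\dots\ge c_{\lambda+1}\ge 1$ ($\lambda$ = number of intermediate layers; here $\lambda=1$), and $\alpha\in[0,1]$. A topology is a rooted forest (edges directed from child to parent) of height at most $\lambda+1$ whose leaves are exactly $S$ and whose roots lie in $T$ (other vertices are Steiner vertices); the layer of a vertex is its distance to its root; the load $\ell(v)$ is the number of sources in the subtree of $v$ and the load of edge $uv$ ($u$ child) is $\ell(u)$; it is valid if $\ell(v)\le c_i$ for every vertex $v$ in layer $i$. An embedding maps sources and sinks to their positions and Steiner vertices to arbitrary points; edge cost is $\|\mathrm{pos}(u)-\mathrm{pos}(v)\|\cdot\ell(uv)^\alpha$; a layout is a topology with an embedding, its cost the sum of edge costs; the instance is feasible if a valid layout exists. A circular instance has all sources on a circle and all sinks at its center; it is source-equally-spaced if the $n$ sources are evenly distributed on the circle (consecutive sources separated by angle $2\pi/n$). For a layout with one intermediate layer, a Steiner vertex is $k$-consecutive with respect to an ordering of the sources if its children can be partitioned into at most $k$ sequences of sources that are consecutive in that ordering; a layout is $k$-consecutive if all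 its Steiner vertices are. *)

theory Defs
  imports "HOL-Analysis.Analysis" "HOL-Library.Sublist" "HOL-Library.Disjoint_Sets"
begin

text \<open>The norm on the product type \<^typ>\<open>real \<times> real\<close> is the Euclidean one.\<close>

type_synonym point = "real \<times> real"

text \<open>
  The list \<open>caps\<close> is \<open>[c\<^sub>0, \<dots>, c\<^bsub>\<lambda>+1\<^esub>]\<close>, where \<open>\<lambda>\<close> is the number of intermediate layers.
\<close>

record ('s, 't) flamecast =
  sources :: "'s set"
  sinks :: "'t set"
  source_pos :: "'s \<Rightarrow> point"
  sink_pos :: "'t \<Rightarrow> point"
  caps :: "nat list"
  expo :: real

definition flamecast_instance :: "('s, 't) flamecast \<Rightarrow> bool" where
  "flamecast_instance I \<longleftrightarrow>
     finite (sources I) \<and> finite (sinks I) \<and>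
     length (caps I) \<ge> 2 \<and> sorted_wrt (\<ge>) (caps I) \<and> (\<forall>c \<in> set (caps I). c \<ge> 1) \<and>
     0 \<le> expo I \<and> expo I \<le> 1"

definition intermediate_layers :: "('s, 't) flamecast \<Rightarrow> nat" where
  "intermediate_layers I = length (caps I) - 2"

text \<open>
  Steiner vertices are drawn from an infinite supply of names, so that every finite topology is
  represented up to renaming of its Steiner vertices.
\<close>

datatype ('s, 't) vertex = Source 's | Sink 't | Steiner nat

text \<open>Edges are pairs (child, parent).\<close>

record ('s, 't) layout =
  verts :: "('s, 't) vertex set"
  edges :: "(('s, 't) vertex \<times> ('s, 't) vertex) set"
  pos :: "('s, 't) vertex \<Rightarrow> point"

definition rooted_forest :: "'v set \<Rightarrow> ('v \<times> 'v) set \<Rightarrow> bool" where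
  "rooted_forest V E \<longleftrightarrow> finite V \<and> E \<subseteq> V \<times> V \<and> single_valued E \<and> acyclic E"

definition leaves :: "'v set \<Rightarrow> ('v \<times> 'v) set \<Rightarrow> 'v set" where
  "leaves V E = V - Range E"

definition roots :: "'v set \<Rightarrow> ('v \<times> 'v) set \<Rightarrow> 'v set" where
  "roots V E = V - Domain E"

definition children :: "('v \<times> 'v) set \<Rightarrow> 'v \<Rightarrow> 'v set" where
  "children E v = {u. (u, v) \<in> E}"

text \<open>In a rooted forest the number of steps from a vertex to its root is unique.\<close>

definition layer :: "'v set \<Rightarrow> ('v \<times> 'v) set \<Rightarrow> 'v \<Rightarrow> nat" where
  "layer V E v = (LEAST n. \<exists>r \<in> roots V E. (v, r) \<in> E ^^ n)"

definition load ::
  "('s, 't) flamecast \<Rightarrow> (('s, 't) vertex \<times> ('s, 't) vertex) set \<Rightarrow> ('s, 't) vertex \<Rightarrow> nat" where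
  "load I E v = card {s \<in> sources I. (Source s, v) \<in> E\<^sup>*}"

definition is_topology ::
  "('s, 't) flamecast \<Rightarrow> ('s, 't) vertex set \<Rightarrow> (('s, 't) vertex \<times> ('s, 't) vertex) set \<Rightarrow> bool" where
  "is_topology I V E \<longleftrightarrow>
     rooted_forest V E \<and>
     leaves V E = Source ` sources I \<and>
     roots V E \<subseteq> Sink ` sinks I \<and>
     V - (leaves V E \<union> roots V E) \<subseteq> range Steiner \<and>
     (\<forall>v \<in> V. layer V E v \<le> intermediate_layers I + 1)"

definition is_embedding :: "('s, 't) flamecast \<Rightarrow> (('s, 't) vertex \<Rightarrow> point) \<Rightarrow> bool" where
  "is_embedding I p \<longleftrightarrow>
     (\<forall>s \<in> sources I. p (Source s) = source_pos I s) \<and>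
     (\<forall>t \<in> sinks I. p (Sink t) = sink_pos I t)"

definition is_layout :: "('s, 't) flamecast \<Rightarrow> ('s, 't) layout \<Rightarrow> bool" where
  "is_layout I L \<longleftrightarrow> is_topology I (verts L) (edges L) \<and> is_embedding I (pos L)"

definition valid_layout :: "('s, 't) flamecast \<Rightarrow> ('s, 't) layout \<Rightarrow> bool" where
  "valid_layout I L \<longleftrightarrow>
     is_layout I L \<and>
     (\<forall>v \<in> verts L. load I (edges L) v \<le> caps I ! layer (verts L) (edges L) v)"

definition cost :: "('s, 't) flamecast \<Rightarrow> ('s, 't) layout \<Rightarrow> real" where
  "cost I L =
     (\<Sum>(u, v) \<in> edges L. norm (pos L u - pos L v) * real (load I (edges L) u) powr expo I)"

definition feasible :: "('s, 't) flamecast \<Rightarrow> bool" where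
  "feasible I \<longleftrightarrow> (\<exists>L. valid_layout I L)"

definition min_cost_layout :: "('s, 't) flamecast \<Rightarrow> ('s, 't) layout \<Rightarrow> bool" where
  "min_cost_layout I L \<longleftrightarrow> valid_layout I L \<and> (\<forall>L'. valid_layout I L' \<longrightarrow> cost I L \<le> cost I L')"

definition circle_point :: "point \<Rightarrow> real \<Rightarrow> real \<Rightarrow> point" where
  "circle_point z r \<theta> = z + r *\<^sub>R (cos \<theta>, sin \<theta>)"

definition circular :: "('s, 't) flamecast \<Rightarrow> point \<Rightarrow> real \<Rightarrow> bool" where
  "circular I z r \<longleftrightarrow>
     r > 0 \<and> (\<forall>s \<in> sources I. source_pos I s \<in> sphere z r) \<and> (\<forall>t \<in> sinks I. sink_pos I t = z)"

definition source_equally_spaced :: "('s, 't) flamecast \<Rightarrow> point \<Rightarrow> real \<Rightarrow> bool" where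
  "source_equally_spaced I z r \<longleftrightarrow>
     (\<exists>\<theta>. bij_betw (source_pos I) (sources I)
        ((\<lambda>k. circle_point z r (\<theta> + 2 * pi * real k / real (card (sources I))))
           ` {..<card (sources I)}))"

text \<open>
  The list \<open>xs\<close> enumerates the sources in the order in which they are met on one counterclockwise
  turn around the circle that begins at \<open>s\<close>; \<open>\<theta> i\<close> is the polar angle of the \<open>i\<close>-th one.
\<close>

definition ccw_ordering_from ::
  "('s, 't) flamecast \<Rightarrow> point \<Rightarrow> real \<Rightarrow> 's \<Rightarrow> 's list \<Rightarrow> bool" where
  "ccw_ordering_from I z r s xs \<longleftrightarrow>
     distinct xs \<and> set xs = sources I \<and> xs \<noteq> [] \<and> hd xs = s \<and>
     (\<exists>\<theta> :: nat \<Rightarrow> real.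
        (\<forall>i j. i < j \<and> j < length xs \<longrightarrow> \<theta> i \<le> \<theta> j) \<and>
        (\<forall>i < length xs. \<theta> i < \<theta> 0 + 2 * pi \<and> source_pos I (xs ! i) = circle_point z r (\<theta> i)))"

definition k_consecutive_vertex ::
  "nat \<Rightarrow> 's list \<Rightarrow> (('s, 't) vertex \<times> ('s, 't) vertex) set \<Rightarrow> ('s, 't) vertex \<Rightarrow> bool" where
  "k_consecutive_vertex k xs E v \<longleftrightarrow>
     (\<exists>P. partition_on (children E v) P \<and> finite P \<and> card P \<le> k \<and>
          (\<forall>B \<in> P. \<exists>ys. sublist ys xs \<and> B = Source ` set ys))"

definition k_consecutive :: "nat \<Rightarrow> 's list \<Rightarrow> ('s, 't) layout \<Rightarrow> bool" where
  "k_consecutive k xs L \<longleftrightarrow>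
     (\<forall>v \<in> verts L \<inter> range Steiner. k_consecutive_vertex k xs (edges L) v)"

end

theory Submission imports Defs begin

text \<open>
  With one intermediate layer and one sink, a topology clusters the sources, each cluster being
  joined through a Steiner vertex (its hub) to the sink. For a fixed hub, the distance to a point of
  the circle increases with the angular distance from the hub, so the \<open>k\<close> closest sources form an
  arc. Rotating the hub about the centre moves this arc onto any other arc of \<open>k\<close> sources, so all
  arcs of size \<open>k\<close> have the same optimal cost, and no cluster of size \<open>k\<close> is cheaper. Hence only the
  cluster sizes matter: cutting the linear order into consecutive blocks of the same sizes costs no
  more than the given layout. There are finitely many lists of sizes, and for each size an optimal
  hub exists by compactness, so the minimum is attained.
\<close>

section \<open>Arcs of equally spaced points on a circle\<close>

text \<open>The law of cosines about \<open>z\<close>. Only the difference of the two angles enters,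
  so rotating points and hub together preserves distances.\<close>

lemma norm_circle_point_diff:
  "norm (circle_point z r a - circle_point z s b) = sqrt (r\<^sup>2 + s\<^sup>2 - 2 * r * s * cos (a - b))"
proof -
  have "(r * cos a - s * cos b)\<^sup>2 + (r * sin a - s * sin b)\<^sup>2
      = r\<^sup>2 * ((sin a)\<^sup>2 + (cos a)\<^sup>2) + s\<^sup>2 * ((sin b)\<^sup>2 + (cos b)\<^sup>2) - 2 * r * s * cos (a - b)"
    unfolding cos_diff by algebra
  then show ?thesis
    by (cases z) (simp add: circle_point_def norm_Pair)
qed

lemma norm_circle_point_center: "norm (circle_point z r a - z) = \<bar>r\<bar>"
proof -
  have "(r * cos a)\<^sup>2 + (r * sin a)\<^sup>2 = r\<^sup>2 * ((sin a)\<^sup>2 + (cos a)\<^sup>2)"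
    by algebra
  then show ?thesis
    by (cases z) (simp add: circle_point_def norm_Pair)
qed

lemma polar_point:
  obtains \<rho> \<phi> where "\<rho> \<ge> 0" "p = circle_point z \<rho> \<phi>"
proof -
  let ?w = "Complex (fst (p - z)) (snd (p - z))"
  have "?w = rcis (cmod ?w) (Arg ?w)"
    by (simp add: rcis_cmod_Arg)
  then have "p - z = cmod ?w *\<^sub>R (cos (Arg ?w), sin (Arg ?w))"
    by (simp add: complex_eq_iff prod_eq_iff)
  then show ?thesis
    by (intro that[of "cmod ?w" "Arg ?w"]) (auto simp: circle_point_def algebra_simps)
qed

lemma sum_int_window: "(\<Sum>i<n. f (a + int i)) = sum f {a..<a + int n}"
  by (rule sum.reindex_bij_witness[of _ "\<lambda>j. nat (j - a)" "\<lambda>i. a + int i"]) auto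

text \<open>
  The maximum of \<open>q\<close> over the window sits at an end of the window: while \<open>G\<close> has a gap, that end
  can be exchanged for the gap (if it is in \<open>G\<close>) and dropped from the window.
\<close>

lemma quasiconvex_min_window:
  fixes q :: "int \<Rightarrow> real"
  assumes "\<And>i j l. \<lbrakk>a \<le> i; i \<le> j; j \<le> l; l < a + int n\<rbrakk> \<Longrightarrow> q j \<le> q i \<or> q j \<le> q l"
    and "G \<subseteq> {a..<a + int n}"
  shows "\<exists>b. (\<Sum>i<card G. q (b + int i)) \<le> sum q G"
  using assms
proof (induction n arbitrary: a G)
  case 0
  then show ?case by simp
next
  case (Suc n)
  have fin: "finite G"
    using Suc.prems(2) finite_subset by blast
  show ?case
  proof (cases "G = {a..<a + int (Suc n)}")
    case True
    then have "card G = Suc n" by simp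
    then show ?thesis
      using True by (metis order_refl sum_int_window)
  next
    case False
    then obtain c where c: "c \<in> {a..<a + int (Suc n)}" "c \<notin> G"
      using Suc.prems(2) by blast
    \<comment> \<open>The window has \<open>Suc n\<close> indices, so its ends are \<open>a\<close>
      and \<open>a + int n\<close>.\<close>
    have "q c \<le> q a \<or> q c \<le> q (a + int n)"
      using c by (intro Suc.prems(1)) auto
    then obtain e where e: "e = a \<or> e = a + int n" "q c \<le> q e"
      by blast
    \<comment> \<open>\<open>G'\<close> has the size of \<open>G\<close>, no larger sum, and avoids
      the end \<open>e\<close>, so it fits into a window shorter by one.\<close>
    define G' where "G' = (if e \<in> G then insert c (G - {e}) else G)"
    have card: "card G' = card G"
      proof (cases "e \<in> G")
      case True
      then have "card G' = Suc (card (G - {e}))"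
        using fin c by (simp add: G'_def)
      then show ?thesis
        using card_Suc_Diff1[OF fin True] by simp
    qed (simp add: G'_def)
    have sum: "sum q G' \<le> sum q G"
      using fin c e by (auto simp: G'_def sum_diff1)
    have sub: "G' \<subseteq> {a..<a + int (Suc n)} - {e}"
      using c Suc.prems(2) by (auto simp: G'_def)
    obtain a' where a': "a' = a \<or> a' = a + 1" "{a..<a + int (Suc n)} - {e} = {a'..<a' + int n}"
    proof (cases "e = a")
      case True
      then have "{a..<a + int (Suc n)} - {e} = {a + 1..<a + 1 + int n}" by auto
      then show ?thesis using that by blast
    next
      case False
      then have "{a..<a + int (Suc n)} - {e} = {a..<a + int n}" using e(1) by auto
      then show ?thesis using that by blast
    qed
    have "\<exists>b. (\<Sum>i<card G'. q (b + int i)) \<le> sum q G'"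
    proof (rule Suc.IH[of a'])
      fix i j l
      assume "a' \<le> i" "i \<le> j" "j \<le> l" "l < a' + int n"
      then show "q j \<le> q i \<or> q j \<le> q l"
        using a'(1) by (intro Suc.prems(1)) auto
    qed (use sub a'(2) in simp)
    then show ?thesis
      using card sum by (metis order_trans)
  qed
qed

text \<open>Seen from the hub, distance is quasiconvex along one full turn centred at the hub's
  direction, so \<open>quasiconvex_min_window\<close> replaces \<open>G\<close> by some arc of equal
  size. Rotating the hub then makes this arc start at the prescribed index \<open>a\<close>.\<close>

lemma arc_optimal:
  fixes z p :: point and r \<theta> :: real and n a :: nat
  defines "P \<equiv> \<lambda>i::nat. circle_point z r (\<theta> + 2 * pi * real i / real n)"
  assumes "r > 0" and G: "G \<subseteq> {..<n}"
  obtains p' where "norm (p' - z) = norm (p - z)"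
    and "(\<Sum>i<card G. norm (P (a + i) - p')) \<le> (\<Sum>i\<in>G. norm (P i - p))"
proof (cases "n = 0")
  case True
  then show ?thesis using G that[of p] by auto
next
  case False
  then have n: "n > 0" by simp
  obtain \<rho> \<phi> where \<rho>: "\<rho> \<ge> 0" and p: "p = circle_point z \<rho> \<phi>"
    by (rule polar_point)
  \<comment> \<open>\<open>x j\<close> is the angular offset of the \<open>j\<close>-th point from
    the hub's direction. Integer indices let an arc run past the starting point of the numbering in
    either direction.\<close>
  define x where "x = (\<lambda>j::int. \<theta> - \<phi> + 2 * pi * real_of_int j / real n)"
  define h where "h = (\<lambda>c. sqrt (r\<^sup>2 + \<rho>\<^sup>2 - 2 * r * \<rho> * c))"
  define q where "q = (\<lambda>j. h (cos (x j)))"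
  have h_mono: "h c \<le> h d" if "d \<le> c" for c d
    using that \<open>r > 0\<close> \<rho> by (auto simp: h_def intro!: mult_left_mono)
  have x_mono: "x i \<le> x j" if "i \<le> j" for i j
    using that n by (auto simp: x_def divide_right_mono)
  \<comment> \<open>first index of the full turn of the circle that is centred at the angle \<open>\<phi>\<close>\<close>
  define w where "w = \<lceil>real n * (\<phi> - \<theta> - pi) / (2 * pi)\<rceil>"
  have x_range: "- pi \<le> x j" "x j \<le> pi" if "w \<le> j" "j < w + int n" for j
  proof -
    have "real n * (\<phi> - \<theta> - pi) / (2 * pi) \<le> real_of_int j"
      using that(1) by (simp add: w_def ceiling_le_iff)
    then show "- pi \<le> x j"
      using n by (simp add: x_def field_simps)
    \<comment> \<open>\<open>w\<close> is the least index with offset at least \<open>-pi\<close>.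
      Since \<open>j - int n < w\<close>, going back one full turn from \<open>x j\<close> lands
      below \<open>-pi\<close>.\<close>
    have "real_of_int (j - int n) < real n * (\<phi> - \<theta> - pi) / (2 * pi)"
      using that(2) unfolding w_def by (metis diff_less_eq less_ceiling_iff)
    then show "x j \<le> pi"
      using n by (simp add: x_def field_simps)
  qed
  have q_quasiconvex: "q j \<le> q i \<or> q j \<le> q l" if "w \<le> i" "i \<le> j" "j \<le> l" "l < w + int n" for i j l
  proof -
    \<comment> \<open>On \<open>[0, pi]\<close> the cosine decreases, and \<open>h\<close> is
      antitone, so a larger absolute offset means a larger distance.\<close>
    have q_abs: "q j \<le> q k" if "\<bar>x j\<bar> \<le> \<bar>x k\<bar>" "\<bar>x k\<bar> \<le> pi" for k
    proof -
      have "cos \<bar>x k\<bar> \<le> cos \<bar>x j\<bar>"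
        using that by (intro cos_monotone_0_pi_le) auto
      then show ?thesis
        by (simp add: q_def h_mono)
    qed
    have "x i \<le> x j" "x j \<le> x l"
      using that x_mono by auto
    then have "\<bar>x j\<bar> \<le> \<bar>x i\<bar> \<or> \<bar>x j\<bar> \<le> \<bar>x l\<bar>"
      by linarith
    moreover have "\<bar>x i\<bar> \<le> pi" "\<bar>x l\<bar> \<le> pi"
      using that x_range[of i] x_range[of l] by auto
    ultimately show ?thesis
      using q_abs by blast
  qed
  have q_mod: "q (j mod int n) = q j" for j
  proof -
    have "x j = x (j mod int n) + 2 * pi * real_of_int (j div int n)"
    proof -
      have "real_of_int j = real_of_int (j div int n) * real n + real_of_int (j mod int n)"
        by (metis div_mult_mod_eq of_int_add of_int_mult of_int_of_nat_eq)
      then show ?thesis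
        using n by (simp add: x_def field_simps)
    qed
    then have "cos (x j) = cos (x (j mod int n))"
      by (simp add: cos_add)
    then show ?thesis by (simp add: q_def)
  qed
  have P_q: "norm (P i - p) = q (int i)" for i
    by (simp add: P_def p norm_circle_point_diff q_def h_def x_def algebra_simps)
  \<comment> \<open>The copy of \<open>G\<close> inside the window: each residue class modulo
    \<open>n\<close> has exactly one representative there.\<close>
  define G' where "G' = {j \<in> {w..<w + int n}. nat (j mod int n) \<in> G}"
  have bij: "bij_betw (\<lambda>j. nat (j mod int n)) G' G"
  proof (rule bij_betw_byWitness[where f' = "\<lambda>i. w + (int i - w) mod int n"])
    show "\<forall>j\<in>G'. w + (int (nat (j mod int n)) - w) mod int n = j"
      using n by (auto simp: G'_def mod_diff_left_eq)
    have eq: "(w + (int i - w) mod int n) mod int n = int i" if "i \<in> G" for i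
    proof -
      have "i < n" using G that by auto
      then show ?thesis by (simp add: mod_add_right_eq)
    qed
    then show "\<forall>i\<in>G. nat ((w + (int i - w) mod int n) mod int n) = i"
      by auto
    show "(\<lambda>i. w + (int i - w) mod int n) ` G \<subseteq> G'"
      using eq n by (auto simp: G'_def)
  qed (auto simp: G'_def)
  have "card G' = card G"
    using bij by (rule bij_betw_same_card)
  moreover have "sum q G' = (\<Sum>i\<in>G. norm (P i - p))"
    using n by (subst sum.reindex_bij_betw[OF bij, symmetric]) (simp add: P_q q_mod)
  moreover have "\<exists>b. (\<Sum>i<card G'. q (b + int i)) \<le> sum q G'"
    by (rule quasiconvex_min_window[of w n, OF q_quasiconvex]) (auto simp: G'_def)
  ultimately obtain b where b: "(\<Sum>i<card G. q (b + int i)) \<le> (\<Sum>i\<in>G. norm (P i - p))"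
    by auto
  \<comment> \<open>The hub is rotated by the angle that carries index \<open>b\<close> to index
    \<open>a\<close>.\<close>
  define p' where "p' = circle_point z \<rho> (\<phi> + 2 * pi * real_of_int (int a - b) / real n)"
  have "norm (P (a + i) - p') = q (b + int i)" for i
    using n
    by (simp add: P_def p'_def norm_circle_point_diff q_def h_def x_def algebra_simps
        add_divide_distrib diff_divide_distrib)
  moreover have "norm (p' - z) = norm (p - z)"
    by (simp add: p p'_def norm_circle_point_center)
  ultimately show ?thesis
    using b that by simp
qed

section \<open>Existence of an optimal hub\<close>

text \<open>Outside the disc of radius \<open>F z / w\<close> about \<open>z\<close>, the weighted
  distance to \<open>z\<close> alone exceeds the value at \<open>z\<close>. A minimum over this
  compact disc is therefore global.\<close>

lemma weighted_distance_sum_attains_min: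
  fixes P :: "'a \<Rightarrow> point"
  assumes "w > 0"
  shows "\<exists>p. \<forall>p'. (\<Sum>s\<in>G. norm (P s - p)) + norm (p - z) * w
                \<le> (\<Sum>s\<in>G. norm (P s - p')) + norm (p' - z) * w"
proof -
  define F where "F = (\<lambda>p. (\<Sum>s\<in>G. norm (P s - p)) + norm (p - z) * w)"
  define R where "R = F z / w"
  have "F z \<ge> 0" by (simp add: F_def sum_nonneg)
  then have z: "z \<in> cball z R" using assms by (simp add: R_def)
  have "continuous_on (cball z R) F"
    unfolding F_def by (intro continuous_intros)
  then obtain p where p: "p \<in> cball z R" "\<And>y. y \<in> cball z R \<Longrightarrow> F p \<le> F y"
    using continuous_attains_inf[of "cball z R" F] z by auto
  have "F p \<le> F y" for y
  proof (cases "y \<in> cball z R")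
    case False
    then have "F z < norm (y - z) * w"
      using assms by (simp add: R_def dist_norm norm_minus_commute field_simps)
    also have "\<dots> \<le> F y"
      by (simp add: F_def sum_nonneg)
    finally show ?thesis
      using p(2)[OF z] by simp
  qed (rule p(2))
  then show ?thesis unfolding F_def by blast
qed

section \<open>Angles of a counterclockwise ordering\<close>

lemma circle_point_eq_angle:
  assumes "r \<noteq> 0" "circle_point z r a = circle_point z r b"
  obtains m :: int where "a = b + 2 * pi * real_of_int m"
proof -
  have "cos a = cos b" "sin a = sin b"
    using assms by (auto simp: circle_point_def)
  then have "sin a = sin b \<and> cos a = cos b" by simp
  then show ?thesis
    using that by (auto simp: sin_cos_eq_iff)
qed

text \<open>The values grow by at least one per step. Counting steps from \<open>0\<close> to
  \<open>i\<close> and from \<open>i\<close> to \<open>n - 1\<close> bounds \<open>m i\<close> from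
  below and from above by the same number.\<close>

lemma strict_mono_int_window:
  fixes m :: "nat \<Rightarrow> int"
  assumes mono: "\<And>i j. \<lbrakk>i < j; j < n\<rbrakk> \<Longrightarrow> m i < m j"
    and ub: "\<And>i. i < n \<Longrightarrow> m i < m 0 + int n"
    and "i < n"
  shows "m i = m 0 + int i"
proof -
  have gap: "m i + int d \<le> m (i + d)" if "i + d < n" for i d
    using that
  proof (induction d)
    case (Suc d)
    then show ?case using mono[of "i + d" "i + Suc d"] by simp
  qed simp
  show ?thesis
    using gap[of 0 i] gap[of i "n - 1 - i"] ub[of "n - 1"] \<open>i < n\<close> by simp
qed

text \<open>The ordering only provides weakly increasing angles within less than one turn. Equal
  spacing puts them on a lattice of step \<open>2 * pi / n\<close>, and distinct positions make them
  strictly increasing, so no lattice point is skipped.\<close>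

lemma ccw_ordering_positions:
  assumes "r > 0" "source_equally_spaced I z r" "ccw_ordering_from I z r s xs"
  obtains \<theta> where "\<And>i. i < length xs \<Longrightarrow>
    source_pos I (xs ! i) = circle_point z r (\<theta> + 2 * pi * real i / real (length xs))"
proof -
  define n where "n = length xs"
  have xs: "distinct xs" "set xs = sources I" "xs \<noteq> []"
    using assms(3) by (auto simp: ccw_ordering_from_def)
  have n: "card (sources I) = n" "n > 0"
    using xs distinct_card[of xs] by (auto simp: n_def)
  obtain \<theta> where \<theta>: "\<And>i j. i < j \<Longrightarrow> j < n \<Longrightarrow> \<theta> i \<le> \<theta> j"
    "\<And>i. i < n \<Longrightarrow> \<theta> i < \<theta> 0 + 2 * pi"
    "\<And>i. i < n \<Longrightarrow> source_pos I (xs ! i) = circle_point z r (\<theta> i)"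
    using assms(3) unfolding ccw_ordering_from_def n_def by blast
  obtain \<phi> where \<phi>: "bij_betw (source_pos I) (sources I)
      ((\<lambda>k. circle_point z r (\<phi> + 2 * pi * real k / real n)) ` {..<n})"
    using assms(2) n(1) unfolding source_equally_spaced_def by auto
  \<comment> \<open>A point fixes its angle only up to full turns; a full turn is \<open>n\<close>
    lattice steps, which \<open>m\<close> absorbs.\<close>
  have "\<exists>m::int. \<theta> i = \<phi> + 2 * pi * real_of_int m / real n" if "i < n" for i
  proof -
    have "xs ! i \<in> sources I"
      using that nth_mem[of i xs] by (simp add: xs(2) n_def)
    then have "circle_point z r (\<theta> i)
        \<in> (\<lambda>k. circle_point z r (\<phi> + 2 * pi * real k / real n)) ` {..<n}"
      using bij_betw_apply[OF \<phi>] \<theta>(3)[OF that] by metis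
    then obtain k where k: "circle_point z r (\<theta> i) = circle_point z r (\<phi> + 2 * pi * real k / real n)"
      by blast
    obtain l :: int where "\<theta> i = \<phi> + 2 * pi * real k / real n + 2 * pi * real_of_int l"
      by (rule circle_point_eq_angle[OF _ k]) (use \<open>r > 0\<close> in auto)
    then have "\<theta> i = \<phi> + 2 * pi * real_of_int (int k + l * int n) / real n"
      using n(2) by (simp add: field_simps)
    then show ?thesis by blast
  qed
  then obtain m :: "nat \<Rightarrow> int"
    where m: "\<And>i. i < n \<Longrightarrow> \<theta> i = \<phi> + 2 * pi * real_of_int (m i) / real n"
    by metis
  have \<theta>_inj: "\<theta> i \<noteq> \<theta> j" if "i < j" "j < n" for i j
  proof
    assume "\<theta> i = \<theta> j"
    then have "source_pos I (xs ! i) = source_pos I (xs ! j)"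
      using \<theta>(3) that by simp
    moreover have "xs ! i \<in> sources I" "xs ! j \<in> sources I"
      using that nth_mem[of i xs] nth_mem[of j xs] by (simp_all add: xs(2) n_def)
    ultimately have "xs ! i = xs ! j"
      using \<phi> by (meson bij_betw_imp_inj_on inj_onD)
    then show False
      using that xs(1) by (simp add: nth_eq_iff_index_eq n_def)
  qed
  have m_window: "m i = m 0 + int i" if "i < n" for i
  proof (rule strict_mono_int_window[of n])
    fix i j assume ij: "i < j" "j < n"
    then have "\<theta> i < \<theta> j"
      using \<theta>(1) \<theta>_inj by (simp add: order_less_le)
    then show "m i < m j"
      using m[of i] m[of j] ij n(2) by (simp add: divide_less_cancel)
  next
    fix i assume "i < n"
    then have "2 * pi * real_of_int (m i) / real n < 2 * pi * real_of_int (m 0) / real n + 2 * pi"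
      using \<theta>(2)[of i] m[of i] m[of 0] n(2) by simp
    also have "\<dots> = 2 * pi * real_of_int (m 0 + int n) / real n"
      using n(2) by (simp add: field_simps)
    finally have "real_of_int (m i) < real_of_int (m 0 + int n)"
      using n(2) by (simp only: divide_less_cancel mult_less_cancel_left_pos pi_gt_zero) auto
    then show "m i < m 0 + int n"
      by (simp only: of_int_less_iff)
  qed fact
  have "source_pos I (xs ! i) = circle_point z r (\<theta> 0 + 2 * pi * real i / real n)" if "i < n" for i
    using \<theta>(3)[OF that] m[OF that] m[OF n(2)] m_window[OF that] 
    by (simp add: distrib_left add_divide_distrib add.assoc)
  then show ?thesis
    using that unfolding n_def by blast
qed

section \<open>Topologies with one intermediate layer and one sink\<close>

text \<open>A topology is encoded by the parent \<open>f s\<close> of each source. Only Steiner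
  vertices in the image of \<open>f\<close> occur, since a childless one would be a leaf that is not
  a source.\<close>

definition star_edges ::
  "'s set \<Rightarrow> 't \<Rightarrow> ('s \<Rightarrow> ('s, 't) vertex) \<Rightarrow> (('s, 't) vertex \<times> ('s, 't) vertex) set" where
  "star_edges S t f =
     (\<lambda>s. (Source s, f s)) ` S \<union> (\<lambda>m. (Steiner m, Sink t)) ` {m. Steiner m \<in> f ` S}"

definition star_verts ::
  "'s set \<Rightarrow> 't \<Rightarrow> ('s \<Rightarrow> ('s, 't) vertex) \<Rightarrow> ('s, 't) vertex set" where
  "star_verts S t f = Source ` S \<union> Steiner ` {m. Steiner m \<in> f ` S} \<union> {Sink t}"

definition parent_map :: "'s set \<Rightarrow> 't \<Rightarrow> ('s \<Rightarrow> ('s, 't) vertex) \<Rightarrow> bool" where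
  "parent_map S t f \<longleftrightarrow> f ` S \<subseteq> insert (Sink t) (range Steiner)"

lemma parent_map_cases:
  assumes "parent_map S t f" "s \<in> S"
  obtains "f s = Sink t" | m where "f s = Steiner m"
  using assms unfolding parent_map_def by blast

lemma finite_steiner_image: "finite S \<Longrightarrow> finite {m. Steiner m \<in> f ` S}"
  using finite_vimageI[of "f ` S" Steiner] by (simp add: vimage_def inj_def)

lemma star_edges_Source_iff: "(Source s, v) \<in> star_edges S t f \<longleftrightarrow> s \<in> S \<and> v = f s"
  by (auto simp: star_edges_def)

lemma star_edges_Steiner_iff:
  "(Steiner m, v) \<in> star_edges S t f \<longleftrightarrow> Steiner m \<in> f ` S \<and> v = Sink t"
  by (auto simp: star_edges_def)

lemma star_edges_Sink: "(Sink x, v) \<notin> star_edges S t f"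
  by (auto simp: star_edges_def)

lemmas star_edges_iffs = star_edges_Source_iff star_edges_Steiner_iff star_edges_Sink

lemma star_rtrancl_Source_iff:
  assumes pm: "parent_map S t f" and "s \<in> S"
  shows "(Source s, v) \<in> (star_edges S t f)\<^sup>* \<longleftrightarrow> v = Source s \<or> v = f s \<or> v = Sink t"
proof
  assume "(Source s, v) \<in> (star_edges S t f)\<^sup>*"
  then show "v = Source s \<or> v = f s \<or> v = Sink t"
  proof (induction rule: rtrancl_induct)
    case (step y w)
    from step.IH show ?case
    proof (elim disjE)
      assume "y = Source s"
      then show ?thesis using step.hyps(2) by (simp add: star_edges_iffs)
    next
      assume "y = f s"
      with parent_map_cases[OF assms] show ?thesis
        using step.hyps(2) by cases (simp_all add: star_edges_iffs)
    next
      assume "y = Sink t"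
      then show ?thesis using step.hyps(2) by (simp add: star_edges_iffs)
    qed
  qed simp
next
  have sf: "(Source s, f s) \<in> star_edges S t f"
    using \<open>s \<in> S\<close> by (simp add: star_edges_iffs)
  have "(f s, Sink t) \<in> (star_edges S t f)\<^sup>*"
    using parent_map_cases[OF assms]
  proof cases
    case (2 m)
    then have "(f s, Sink t) \<in> star_edges S t f"
      using \<open>s \<in> S\<close> by (metis image_eqI star_edges_Steiner_iff)
    then show ?thesis ..
  qed simp
  then have "(Source s, Sink t) \<in> (star_edges S t f)\<^sup>*"
    by (rule converse_rtrancl_into_rtrancl[OF sf])
  then show "v = Source s \<or> v = f s \<or> v = Sink t \<Longrightarrow> (Source s, v) \<in> (star_edges S t f)\<^sup>*"
    using r_into_rtrancl[OF sf] by auto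
qed

lemma load_star:
  assumes "parent_map (sources I) t f"
  shows "s \<in> sources I \<Longrightarrow> load I (star_edges (sources I) t f) (Source s) = 1"
    and "load I (star_edges (sources I) t f) (Steiner m) = card {s \<in> sources I. f s = Steiner m}"
    and "load I (star_edges (sources I) t f) (Sink t) = card (sources I)"
proof -
  assume s: "s \<in> sources I"
  have "{s' \<in> sources I. (Source s', Source s) \<in> (star_edges (sources I) t f)\<^sup>*} = {s}"
  proof -
    have "(Source x, Source s) \<in> (star_edges (sources I) t f)\<^sup>* \<longleftrightarrow> x = s"
      if "x \<in> sources I" for x
      using parent_map_cases[OF assms that]
      by cases (auto simp: star_rtrancl_Source_iff[OF assms that])
    then show ?thesis using s by auto
  qed
  then show "load I (star_edges (sources I) t f) (Source s) = 1"
    by (simp add: load_def)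
next
  show "load I (star_edges (sources I) t f) (Steiner m) = card {s \<in> sources I. f s = Steiner m}"
    unfolding load_def
    by (rule arg_cong[where f = card]) (auto simp: star_rtrancl_Source_iff[OF assms])
  show "load I (star_edges (sources I) t f) (Sink t) = card (sources I)"
    unfolding load_def
    by (rule arg_cong[where f = card]) (auto simp: star_rtrancl_Source_iff[OF assms])
qed

lemma roots_star: "roots (star_verts S t f) (star_edges S t f) = {Sink t}"
  by (auto simp: roots_def star_verts_def star_edges_def Domain_iff)

text \<open>With at least one source the sink has a child; otherwise the sink itself would be a
  leaf.\<close>

lemma leaves_star:
  assumes "parent_map S t f" "S \<noteq> {}"
  shows "leaves (star_verts S t f) (star_edges S t f) = Source ` S"
proof -
  have "Sink t \<in> Range (star_edges S t f)"
  proof -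
    obtain s where s: "s \<in> S" using assms(2) by blast
    show ?thesis
      using parent_map_cases[OF assms(1) s]
    proof cases
      case 1
      then show ?thesis using s star_edges_Source_iff[of s "Sink t" S t f] by auto
    next
      case (2 m)
      then have "Steiner m \<in> f ` S" using s by (metis image_eqI)
      then show ?thesis using star_edges_Steiner_iff[of m "Sink t" S t f] by auto
    qed
  qed
  moreover have "Steiner m \<in> Range (star_edges S t f)" if "Steiner m \<in> f ` S" for m
    using that by (auto simp: star_edges_def Range_iff)
  moreover have "Source s \<notin> Range (star_edges S t f)" for s
    using assms(1) by (auto simp: star_edges_def Range_iff parent_map_def)
  ultimately show ?thesis
    by (auto simp: leaves_def star_verts_def)
qed

text \<open>For sources a bound is enough: their load is 1, which respects every capacity.\<close>

lemma layer_star: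
  assumes "parent_map S t f"
  shows "layer (star_verts S t f) (star_edges S t f) (Sink t) = 0"
    and "Steiner m \<in> f ` S \<Longrightarrow> layer (star_verts S t f) (star_edges S t f) (Steiner m) = 1"
    and "s \<in> S \<Longrightarrow> layer (star_verts S t f) (star_edges S t f) (Source s) \<le> 2"
proof -
  show "layer (star_verts S t f) (star_edges S t f) (Sink t) = 0"
    by (simp add: layer_def roots_star)
next
  assume m: "Steiner m \<in> f ` S"
  show "layer (star_verts S t f) (star_edges S t f) (Steiner m) = 1"
    unfolding layer_def roots_star
  proof (rule Least_equality)
    show "\<exists>r\<in>{Sink t}. (Steiner m, r) \<in> star_edges S t f ^^ 1"
      using m by (simp add: star_edges_iffs)
  next
    fix n assume "\<exists>r\<in>{Sink t}. (Steiner m, r) \<in> star_edges S t f ^^ n"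
    then show "1 \<le> n" by (cases n) auto
  qed
next
  assume s: "s \<in> S"
  have "\<exists>n\<le>2. (Source s, Sink t) \<in> star_edges S t f ^^ n"
    using parent_map_cases[OF assms s]
  proof cases
    case 1
    then have "(Source s, Sink t) \<in> star_edges S t f ^^ 1"
      using s by (simp add: star_edges_iffs)
    then show ?thesis by (intro exI[of _ 1]) auto
  next
    case (2 m)
    then have "Steiner m \<in> f ` S" using s by (metis image_eqI)
    then have "(Source s, Steiner m) \<in> star_edges S t f" "(Steiner m, Sink t) \<in> star_edges S t f"
      using s 2 by (auto simp: star_edges_iffs)
    then have "(Source s, Sink t) \<in> star_edges S t f ^^ 2"
      by (auto simp: numeral_2_eq_2)
    then show ?thesis by blast
  qed
  then obtain n where n: "n \<le> 2" "\<exists>r\<in>{Sink t}. (Source s, r) \<in> star_edges S t f ^^ n"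
    by blast
  show "layer (star_verts S t f) (star_edges S t f) (Source s) \<le> 2"
    unfolding layer_def roots_star
    by (rule order_trans[OF Least_le
          [where P = "\<lambda>n. \<exists>r\<in>{Sink t}. (Source s, r) \<in> star_edges S t f ^^ n", OF n(2)] n(1)])
qed

lemma rooted_forest_star:
  fixes f :: "'s \<Rightarrow> ('s, 't) vertex"
  assumes "parent_map S t f" "finite S"
  shows "rooted_forest (star_verts S t f) (star_edges S t f)"
proof -
  \<comment> \<open>A rank that strictly drops along every edge, which excludes cycles.\<close>
  define h :: "('s, 't) vertex \<Rightarrow> nat"
    where "h = (\<lambda>v. case v of Source _ \<Rightarrow> 2 | Steiner _ \<Rightarrow> 1 | Sink _ \<Rightarrow> 0)"
  have "star_edges S t f \<subseteq> (Wellfounded.measure h)\<inverse>"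
  proof (intro subrelI)
    fix u v assume uv: "(u, v) \<in> star_edges S t f"
    show "(u, v) \<in> (Wellfounded.measure h)\<inverse>"
    proof (cases u)
      case (Source s)
      then have "s \<in> S" "v = f s" using uv by (auto simp: star_edges_iffs)
      from parent_map_cases[OF assms(1) this(1)] show ?thesis
        using Source \<open>v = f s\<close> by cases (simp_all add: h_def)
    qed (use uv in \<open>auto simp: h_def star_edges_iffs\<close>)
  qed
  then have "acyclic (star_edges S t f)"
    by (meson acyclic_converse acyclic_subset wf_acyclic wf_measure)
  moreover have "single_valued (star_edges S t f)"
    unfolding single_valued_def
  proof (intro allI impI)
    fix u v w assume "(u, v) \<in> star_edges S t f" "(u, w) \<in> star_edges S t f"
    then show "v = w"
      by (cases u) (simp_all add: star_edges_iffs)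
  qed
  moreover have "star_edges S t f \<subseteq> star_verts S t f \<times> star_verts S t f"
  proof -
    have "f s \<in> star_verts S t f" if "s \<in> S" for s
      using parent_map_cases[OF assms(1) that]
    proof cases
      case (2 m)
      then have "Steiner m \<in> f ` S" using that by (metis image_eqI)
      then show ?thesis using 2 by (simp add: star_verts_def)
    qed (simp add: star_verts_def)
    then show ?thesis by (auto simp: star_edges_def star_verts_def)
  qed
  moreover have "finite (star_verts S t f)"
    using assms(2) by (simp add: star_verts_def finite_steiner_image)
  ultimately show ?thesis by (simp add: rooted_forest_def)
qed

section \<open>Every topology is a star\<close>

text \<open>\<open>layer\<close> is a \<open>LEAST\<close>, so it is informative only once some root
  is known to be reachable. In a finite acyclic graph the converse relation is well-founded, so
  climbing from child to parent must stop at a root.\<close>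

lemma rooted_forest_path_to_root:
  assumes "rooted_forest V E" "v \<in> V"
  shows "\<exists>r\<in>roots V E. (v, r) \<in> E ^^ layer V E v"
proof -
  have E: "finite E" "E \<subseteq> V \<times> V" "acyclic E"
    using assms(1) finite_subset[of E "V \<times> V"] by (auto simp: rooted_forest_def)
  then have "wf (E\<inverse>)"
    by (simp add: finite_acyclic_wf_converse)
  then have "v \<in> V \<longrightarrow> (\<exists>n. \<exists>r\<in>roots V E. (v, r) \<in> E ^^ n)"
  proof (induction v rule: wf_induct_rule)
    case (less v)
    show ?case
    proof (cases "v \<in> Domain E")
      case True
      then obtain u where u: "(v, u) \<in> E" by blast
      moreover have "u \<in> V"
        using u E(2) by blast
      ultimately obtain n r where "r \<in> roots V E" "(u, r) \<in> E ^^ n"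
        using less.IH[of u] by blast
      then show ?thesis
        using u by (meson relpow_Suc_I2)
    next
      case False
      then show ?thesis
        by (metis DiffI relpow_0_I roots_def)
    qed
  qed
  then have "\<exists>n. \<exists>r\<in>roots V E. (v, r) \<in> E ^^ n"
    using assms(2) by blast
  then show ?thesis
    unfolding layer_def by (rule LeastI_ex)
qed

text \<open>Height at most two forces this shape: a Steiner vertex is not a leaf, so it has a child,
  and that child is within two steps of the sink. Hence Steiner vertices hang directly from the
  sink, and only sources hang from them.\<close>

lemma topology_is_star:
  assumes top: "is_topology I V E" and sinks: "sinks I = {t}"
    and layers: "intermediate_layers I = 1" and "sources I \<noteq> {}"
  obtains f where "parent_map (sources I) t f"
    "V = star_verts (sources I) t f" "E = star_edges (sources I) t f"
proof -
  let ?S = "sources I"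
  have forest: "rooted_forest V E" and E: "E \<subseteq> V \<times> V" and sv: "single_valued E"
    and leaves: "V - Range E = Source ` ?S"
    and roots_sub: "roots V E \<subseteq> {Sink t}"
    and other: "V - (leaves V E \<union> roots V E) \<subseteq> range Steiner"
    and lay: "\<And>v. v \<in> V \<Longrightarrow> layer V E v \<le> 2"
    using top sinks layers by (auto simp: is_topology_def rooted_forest_def leaves_def)
  have root_iff: "roots V E = V - Domain E" by (simp add: roots_def)
  have path: "\<exists>n\<le>2. (v, Sink t) \<in> E ^^ n" if "v \<in> V" for v
    using rooted_forest_path_to_root[OF forest that] lay[OF that] roots_sub by blast
  have vert_cases: "(\<exists>s\<in>?S. v = Source s) \<or> (\<exists>m. v = Steiner m) \<or> v = Sink t" if "v \<in> V" for v
    using that other leaves roots_sub by (auto simp: leaves_def)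
  \<comment> \<open>A sink with a parent would be neither a leaf nor a root, and would therefore
    have to be a Steiner vertex.\<close>
  have sink_root: "(Sink t, v) \<notin> E" for v
  proof
    assume v: "(Sink t, v) \<in> E"
    then have "Sink t \<in> V - (leaves V E \<union> roots V E)"
      using E leaves by (auto simp: leaves_def root_iff)
    then show False using other by auto
  qed
  have sourceV: "Source s \<in> V" "Source s \<notin> Range E" if "s \<in> ?S" for s
    using leaves that by auto
  have steiner_parent: "(Steiner m, Sink t) \<in> E" if m: "Steiner m \<in> V" for m
  proof -
    have "Steiner m \<in> Range E"
      using leaves m by auto
    then obtain w where w: "(w, Steiner m) \<in> E" by blast
    then obtain n where n: "n \<le> 2" "(w, Sink t) \<in> E ^^ n"
      using path E by blast
    have "n \<noteq> 0"
      using n(2) w sink_root by (metis prod.inject relpow_0_E)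
    then obtain k where k: "n = Suc k" by (cases n) auto
    then obtain y where y: "(w, y) \<in> E" "(y, Sink t) \<in> E ^^ k"
      using n(2) by (metis relpow_Suc_D2)
    \<comment> \<open>Parents are unique, so the path from \<open>w\<close> passes through
      \<open>Steiner m\<close> and has at most one edge left to the sink.\<close>
    have "y = Steiner m"
      using sv w y(1) by (meson single_valuedD)
    moreover have "k = 0 \<or> k = 1" using n(1) k by auto
    ultimately show ?thesis using y(2) by auto
  qed
  have source_parent: "\<exists>v. (Source s, v) \<in> E \<and> (v = Sink t \<or> v \<in> range Steiner)" if s: "s \<in> ?S" for s
  proof -
    obtain n where "(Source s, Sink t) \<in> E ^^ n"
      using path sourceV(1)[OF s] by blast
    then obtain v where v: "(Source s, v) \<in> E"
      by (metis relpow_E2 vertex.distinct(1))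
    then have "v \<in> V" "v \<in> Range E" using E by auto
    then show ?thesis
      using vert_cases[of v] sourceV(2) v by auto
  qed
  then obtain f where f: "\<And>s. s \<in> ?S \<Longrightarrow> (Source s, f s) \<in> E"
    "\<And>s. s \<in> ?S \<Longrightarrow> f s = Sink t \<or> f s \<in> range Steiner"
    by metis
  have steiner_iff: "Steiner m \<in> V \<longleftrightarrow> Steiner m \<in> f ` ?S" for m
  proof
    assume m: "Steiner m \<in> V"
    then have "Steiner m \<in> Range E"
      using leaves by auto
    then obtain w where w: "(w, Steiner m) \<in> E" by blast
    then have "w \<in> V" using E by auto
    \<comment> \<open>The only parent of a Steiner vertex is the sink.\<close>
    moreover have "w \<noteq> Steiner k" for k
      using steiner_parent[of k] w sv \<open>w \<in> V\<close> by (auto dest: single_valuedD)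
    ultimately obtain s where "s \<in> ?S" "w = Source s"
      using vert_cases w sink_root by blast
    then show "Steiner m \<in> f ` ?S"
      using f(1) w sv by (metis image_eqI single_valuedD)
  next
    assume "Steiner m \<in> f ` ?S"
    then obtain s where "(Source s, Steiner m) \<in> E"
      using f(1) by (metis imageE)
    then show "Steiner m \<in> V" using E by blast
  qed
  have "E = star_edges ?S t f"
  proof (intro equalityI subrelI)
    fix u v assume uv: "(u, v) \<in> E"
    then have "u \<in> V" using E by auto
    then consider s where "s \<in> ?S" "u = Source s" | m where "u = Steiner m" | "u = Sink t"
      using vert_cases by blast
    then show "(u, v) \<in> star_edges ?S t f"
    proof cases
      case 1
      then show ?thesis using f(1) uv sv by (auto simp: star_edges_iffs dest: single_valuedD)
    next
      case 2
      then show ?thesis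
        using steiner_parent steiner_iff uv sv \<open>u \<in> V\<close>
        by (auto simp: star_edges_iffs dest: single_valuedD)
    next
      case 3
      then show ?thesis using uv sink_root by simp
    qed
  next
    fix u v assume "(u, v) \<in> star_edges ?S t f"
    then show "(u, v) \<in> E"
      using f(1) steiner_parent steiner_iff by (auto simp: star_edges_def)
  qed
  moreover have "Sink t \<in> V"
  proof -
    obtain s where "s \<in> ?S" using assms(4) by blast
    then obtain r where "r \<in> roots V E"
      using rooted_forest_path_to_root[OF forest] sourceV(1) by blast
    then show ?thesis using roots_sub by (auto simp: roots_def)
  qed
  then have "V = star_verts ?S t f"
    using vert_cases sourceV(1) steiner_iff by (auto simp: star_verts_def) blast
  moreover have "parent_map ?S t f"
    using f(2) by (auto simp: parent_map_def)
  ultimately show ?thesis using that by blast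
qed

section \<open>Clusterings of the sources\<close>

text \<open>Sources have load 1 and never violate a capacity. The condition may range over all names
  \<open>m\<close>, because the names that do not occur have an empty cluster.\<close>

lemma valid_layout_star_iff:
  assumes inst: "flamecast_instance I" and sinks: "sinks I = {t}"
    and layers: "intermediate_layers I = 1" and ne: "sources I \<noteq> {}"
    and pm: "parent_map (sources I) t f" and emb: "is_embedding I (pos L)"
    and V: "verts L = star_verts (sources I) t f" and E: "edges L = star_edges (sources I) t f"
  shows "valid_layout I L \<longleftrightarrow>
    (\<forall>m. card {s \<in> sources I. f s = Steiner m} \<le> caps I ! 1) \<and> card (sources I) \<le> caps I ! 0"
proof -
  have fin: "finite (sources I)" and len: "length (caps I) = 3"
    and caps: "\<And>i. i < 3 \<Longrightarrow> 1 \<le> caps I ! i"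
    using inst layers by (auto simp: flamecast_instance_def intermediate_layers_def)
  let ?V = "star_verts (sources I) t f" and ?E = "star_edges (sources I) t f"
  have lay: "layer ?V ?E v \<le> 2" if "v \<in> ?V" for v
  proof -
    consider s where "s \<in> sources I" "v = Source s" | m where "Steiner m \<in> f ` sources I" "v = Steiner m"
      | "v = Sink t"
      using \<open>v \<in> ?V\<close> unfolding star_verts_def by blast
    then show ?thesis
      by cases (simp_all add: layer_star[OF pm])
  qed
  have "?V - (Source ` sources I \<union> {Sink t}) \<subseteq> range Steiner"
    by (auto simp: star_verts_def)
  then have "is_topology I ?V ?E"
    unfolding is_topology_def leaves_star[OF pm ne] roots_star
    using rooted_forest_star[OF pm fin] lay sinks layers by (simp add: numeral_2_eq_2)
  then have "is_layout I L"
    using emb V E by (simp add: is_layout_def)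
  then have valid: "valid_layout I L \<longleftrightarrow> (\<forall>v\<in>?V. load I ?E v \<le> caps I ! layer ?V ?E v)"
    by (simp add: valid_layout_def V E)
  have source: "load I ?E (Source s) \<le> caps I ! layer ?V ?E (Source s)" if "s \<in> sources I" for s
    using that layer_star(3)[OF pm that] load_star(1)[OF pm that] caps by simp
  have steiner: "load I ?E (Steiner m) \<le> caps I ! layer ?V ?E (Steiner m) \<longleftrightarrow>
      card {s \<in> sources I. f s = Steiner m} \<le> caps I ! 1" if "Steiner m \<in> f ` sources I" for m
    using layer_star(2)[OF pm that] by (simp add: load_star(2)[OF pm])
  have empty: "card {s \<in> sources I. f s = Steiner m} \<le> caps I ! 1" if "Steiner m \<notin> f ` sources I" for m
  proof -
    have "{s \<in> sources I. f s = Steiner m} = {}"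
      using that by (metis (mono_tags, lifting) empty_Collect_eq image_eqI)
    then show ?thesis by (metis card.empty le0)
  qed
  have sink: "load I ?E (Sink t) \<le> caps I ! layer ?V ?E (Sink t) \<longleftrightarrow> card (sources I) \<le> caps I ! 0"
    by (simp add: load_star(3)[OF pm] layer_star(1)[OF pm])
  have "(\<forall>v\<in>?V. load I ?E v \<le> caps I ! layer ?V ?E v) \<longleftrightarrow>
      (\<forall>m. Steiner m \<in> f ` sources I \<longrightarrow> load I ?E (Steiner m) \<le> caps I ! layer ?V ?E (Steiner m))
      \<and> load I ?E (Sink t) \<le> caps I ! layer ?V ?E (Sink t)"
    using source unfolding star_verts_def by blast
  then show ?thesis
    unfolding valid sink using steiner empty by blast
qed

text \<open>The cost of joining the cluster \<open>G\<close> through the hub \<open>p\<close> to the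
  sink at \<open>z\<close>. Edges from sources have load 1, hence their lengths are
  unweighted.\<close>

definition cluster_cost :: "('s, 't) flamecast \<Rightarrow> point \<Rightarrow> 's set \<Rightarrow> point \<Rightarrow> real" where
  "cluster_cost I z G p =
     (\<Sum>s\<in>G. norm (source_pos I s - p)) + norm (p - z) * real (card G) powr expo I"

text \<open>
  A source attached directly to the sink is treated as a singleton cluster with hub \<open>z\<close>: the
  hub-to-sink edge then has length 0, so the cost is unchanged.
\<close>

lemma cost_star:
  fixes I :: "('s, 't) flamecast" and f :: "'s \<Rightarrow> ('s, 't) vertex"
  assumes fin: "finite (sources I)" and pm: "parent_map (sources I) t f"
    and E: "edges L = star_edges (sources I) t f"
    and emb: "is_embedding I (pos L)" and t: "t \<in> sinks I" "sink_pos I t = z"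
  defines "A \<equiv> \<lambda>s. if f s = Sink t then Source s else f s"
    and "h \<equiv> \<lambda>b :: ('s, 't) vertex. if b \<in> range Steiner then pos L b else z"
  shows "cost I L = (\<Sum>b\<in>A ` sources I. cluster_cost I z {s \<in> sources I. A s = b} (h b))"
proof -
  let ?S = "sources I" and ?M = "{m. Steiner m \<in> f ` sources I}"
  let ?w = "\<lambda>b. norm (h b - z) * real (card {s \<in> ?S. A s = b}) powr expo I"
  have finM: "finite ?M" using fin by (rule finite_steiner_image)
  have pos_sink: "pos L (Sink t) = z" and pos_source: "\<And>s. s \<in> ?S \<Longrightarrow> pos L (Source s) = source_pos I s"
    using emb t by (auto simp: is_embedding_def)
  have A_Steiner: "A s = Steiner m \<longleftrightarrow> f s = Steiner m" if "s \<in> ?S" for s m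
    by (simp add: A_def)
  have "cost I L = (\<Sum>s\<in>?S. norm (pos L (Source s) - pos L (f s)) * real (load I (edges L) (Source s)) powr expo I)
      + (\<Sum>m\<in>?M. norm (pos L (Steiner m) - pos L (Sink t)) * real (load I (edges L) (Steiner m)) powr expo I)"
    unfolding cost_def E unfolding star_edges_def
    using fin finM
    by (subst sum.union_disjoint) (auto simp: sum.reindex inj_on_def)
  also have "(\<Sum>s\<in>?S. norm (pos L (Source s) - pos L (f s)) * real (load I (edges L) (Source s)) powr expo I)
      = (\<Sum>s\<in>?S. norm (source_pos I s - h (A s)))"
  proof (rule sum.cong)
    fix s assume s: "s \<in> ?S"
    have "pos L (f s) = h (A s)"
      using parent_map_cases[OF pm s] by cases (auto simp: h_def A_def pos_sink)
    then show "norm (pos L (Source s) - pos L (f s)) * real (load I (edges L) (Source s)) powr expo I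
        = norm (source_pos I s - h (A s))"
      using s by (simp add: E load_star(1)[OF pm] pos_source)
  qed simp
  also have "\<dots> = (\<Sum>b\<in>A ` ?S. \<Sum>s | s \<in> ?S \<and> A s = b. norm (source_pos I s - h b))"
    by (subst sum.image_gen[OF fin, of _ A]) (auto intro!: sum.cong)
  also have "(\<Sum>m\<in>?M. norm (pos L (Steiner m) - pos L (Sink t)) * real (load I (edges L) (Steiner m)) powr expo I)
      = (\<Sum>b\<in>Steiner ` ?M. ?w b)"
  proof -
    have "{s \<in> ?S. A s = Steiner m} = {s \<in> ?S. f s = Steiner m}" for m
      using A_Steiner by blast
    then show ?thesis
      by (simp add: sum.reindex inj_on_def E load_star(2)[OF pm] pos_sink h_def)
  qed
  \<comment> \<open>The added labels are sources attached directly to the sink; their hub is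
    \<open>z\<close>, so these terms vanish.\<close>
  also have "\<dots> = (\<Sum>b\<in>A ` ?S. ?w b)"
  proof (rule sum.mono_neutral_left)
    show "Steiner ` ?M \<subseteq> A ` ?S"
    proof
      fix b :: "('s, 't) vertex" assume "b \<in> Steiner ` ?M"
      then obtain m s where "b = Steiner m" "s \<in> ?S" "f s = Steiner m"
        by (smt (verit) imageE mem_Collect_eq)
      then show "b \<in> A ` ?S" by (metis A_Steiner image_eqI)
    qed
    show "\<forall>b\<in>A ` ?S - Steiner ` ?M. ?w b = 0"
    proof
      fix b assume b: "b \<in> A ` ?S - Steiner ` ?M"
      then obtain s where s: "s \<in> ?S" "b = A s" by blast
      have "b \<notin> range Steiner"
      proof
        assume "b \<in> range Steiner"
        then obtain m where m: "b = Steiner m" by blast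
        then have "f s = Steiner m" using s A_Steiner by simp
        then have "m \<in> ?M" using s(1) by (metis (mono_tags) image_eqI mem_Collect_eq)
        then show False using b m by blast
      qed
      then show "?w b = 0" by (simp add: h_def)
    qed
  qed (use fin in simp)
  finally show ?thesis
    by (simp add: cluster_cost_def sum.distrib)
qed

section \<open>Optimality of consecutive clusters\<close>

lemma cluster_cost_attains_min:
  assumes "finite G" "G \<noteq> {}"
  shows "\<exists>p. \<forall>p'. cluster_cost I z G p \<le> cluster_cost I z G p'"
proof -
  have "real (card G) powr expo I > 0"
    using assms by (simp add: card_gt_0_iff)
  from weighted_distance_sum_attains_min[OF this] show ?thesis
    unfolding cluster_cost_def by blast
qed

text \<open>Carries \<open>arc_optimal\<close> from indices to sources: the index in
  \<open>xs\<close> is the position on the circle, and a sublist is an arc. The hub edges cost the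
  same, as cluster sizes and hub distances to \<open>z\<close> agree.\<close>

lemma consecutive_cluster_optimal:
  assumes "r > 0" "distinct xs"
    and pos: "\<And>i. i < length xs \<Longrightarrow>
      source_pos I (xs ! i) = circle_point z r (\<theta> + 2 * pi * real i / real (length xs))"
    and G: "G \<subseteq> set xs" and ys: "sublist ys xs" "length ys = card G"
  shows "\<exists>p'. cluster_cost I z (set ys) p' \<le> cluster_cost I z G p"
proof -
  let ?P = "\<lambda>i. circle_point z r (\<theta> + 2 * pi * real i / real (length xs))"
  obtain us vs where xs: "xs = us @ ys @ vs"
    using ys(1) by (auto simp: sublist_def)
  define J where "J = {i. i < length xs \<and> xs ! i \<in> G}"
  have J: "bij_betw ((!) xs) J G"
    using \<open>distinct xs\<close> G
    by (auto simp: bij_betw_def inj_on_def J_def nth_eq_iff_index_eq image_iff in_set_conv_nth subset_iff)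
  have card_J: "card J = card G"
    using J by (rule bij_betw_same_card)
  have card_ys: "card (set ys) = card G"
    using \<open>distinct xs\<close> xs ys(2) by (simp add: distinct_card)
  obtain p' where p': "norm (p' - z) = norm (p - z)"
    "(\<Sum>i<card J. norm (?P (length us + i) - p')) \<le> (\<Sum>i\<in>J. norm (?P i - p))"
    by (rule arc_optimal[OF \<open>r > 0\<close>, of J "length xs"]) (auto simp: J_def)
  have "(\<Sum>i\<in>J. norm (?P i - p)) = (\<Sum>s\<in>G. norm (source_pos I s - p))"
    by (subst sum.reindex_bij_betw[OF J, symmetric]) (auto simp: J_def pos intro!: sum.cong)
  moreover have "(\<Sum>i<card J. norm (?P (length us + i) - p')) = (\<Sum>s\<in>set ys. norm (source_pos I s - p'))"
  proof -
    have "bij_betw ((!) ys) {..<card J} (set ys)"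
      using \<open>distinct xs\<close> xs ys(2) card_J by (intro bij_betw_nth) auto
    moreover have "source_pos I (ys ! i) = ?P (length us + i)" if "i < card J" for i
    proof -
      have "ys ! i = xs ! (length us + i)" "length us + i < length xs"
        using that ys(2) card_J by (auto simp: xs nth_append)
      then show ?thesis using pos by simp
    qed
    ultimately show ?thesis
      by (subst sum.reindex_bij_betw[symmetric]) (auto intro!: sum.cong)
  qed
  ultimately have "cluster_cost I z (set ys) p' \<le> cluster_cost I z G p"
    using p' by (simp add: cluster_cost_def card_ys)
  then show ?thesis ..
qed

section \<open>Cutting a list into blocks of given lengths\<close>

lemma split_list_by_lengths:
  "sum_list ks = length xs \<Longrightarrow> \<exists>yss. concat yss = xs \<and> map length yss = ks"
proof (induction ks arbitrary: xs)
  case (Cons k ks)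
  then have "sum_list ks = length (drop k xs)" by simp
  then obtain yss where "concat yss = drop k xs" "map length yss = ks"
    using Cons.IH by blast
  then show ?case
    using Cons.prems by (intro exI[of _ "take k xs # yss"]) auto
qed simp

text \<open>\<open>A\<close> maps each entry to the number of its block. Positive lengths make every
  block number occur, and distinctness of \<open>xs\<close> makes the blocks disjoint.\<close>

lemma consecutive_clustering:
  assumes "distinct xs" "sum_list ks = length xs" "\<forall>k\<in>set ks. k > 0"
  obtains A :: "'a \<Rightarrow> nat" where "A ` set xs = {..<length ks}"
    "\<And>m. m < length ks \<Longrightarrow> \<exists>ys. sublist ys xs \<and> length ys = ks ! m \<and> {s \<in> set xs. A s = m} = set ys"
proof -
  obtain yss where yss: "concat yss = xs" "map length yss = ks"
    using split_list_by_lengths[OF assms(2)] by blast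
  have len: "length yss = length ks" "\<And>m. m < length ks \<Longrightarrow> length (yss ! m) = ks ! m"
    by (simp_all flip: yss(2))
  have "\<exists>m. m < length ks \<and> s \<in> set (yss ! m)" if s: "s \<in> set xs" for s
  proof -
    obtain y where "y \<in> set yss" "s \<in> set y"
      using s[folded yss(1)] by auto
    then show ?thesis
      using len(1) by (metis in_set_conv_nth)
  qed
  then obtain A where A: "\<And>s. s \<in> set xs \<Longrightarrow> A s < length ks \<and> s \<in> set (yss ! A s)"
    by metis
  have split: "xs = concat (take m yss) @ yss ! m @ concat (drop (Suc m) yss)" if "m < length ks" for m
    using id_take_nth_drop[of m yss] that len(1) yss(1) by (metis concat.simps(2) concat_append)
  have disj: "m = m'" if "m < length ks" "m' < length ks" "s \<in> set (yss ! m)" "s \<in> set (yss ! m')" for m m' s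
  proof -
    \<comment> \<open>Block \<open>i\<close> lies in the prefix before block \<open>j\<close>, so a
      common element would occur twice in \<open>xs\<close>.\<close>
    have "False" if "i < j" "j < length ks" "s \<in> set (yss ! i)" "s \<in> set (yss ! j)" for i j
    proof -
      have "yss ! i = take j yss ! i" "i < length (take j yss)"
        using that len(1) by auto
      then have "s \<in> set (concat (take j yss))"
        using that(3) nth_mem by (metis UN_I set_concat)
      then show False
        using arg_cong[OF split[OF that(2)], of distinct] \<open>distinct xs\<close> that(4) by auto
    qed
    then show ?thesis using that by (metis linorder_neqE_nat)
  qed
  have sub: "set (yss ! m) \<subseteq> set xs" if "m < length ks" for m
    using arg_cong[OF split[OF that], of set] by auto
  have fiber: "{s \<in> set xs. A s = m} = set (yss ! m)" if "m < length ks" for m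
  proof (intro equalityI subsetI)
    fix s assume "s \<in> set (yss ! m)"
    then show "s \<in> {s \<in> set xs. A s = m}"
      using A[of s] disj[of "A s" m s] sub that by blast
  qed (use A in auto)
  have "A ` set xs = {..<length ks}"
  proof (intro equalityI subsetI)
    fix m assume m: "m \<in> {..<length ks}"
    then have "length (yss ! m) > 0" using len(2) assms(3) by simp
    then have "hd (yss ! m) \<in> {s \<in> set xs. A s = m}"
      using fiber m by simp
    then have "m = A (hd (yss ! m))" "hd (yss ! m) \<in> set xs" by simp_all
    then show "m \<in> A ` set xs" by (rule image_eqI)
  qed (use A in auto)
  moreover have "\<exists>ys. sublist ys xs \<and> length ys = ks ! m \<and> {s \<in> set xs. A s = m} = set ys"
    if "m < length ks" for m
  proof (intro exI conjI)
    show "sublist (yss ! m) xs"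
      unfolding sublist_def by (intro exI) (rule split[OF that])
  qed (fact len(2)[OF that] fiber[OF that])+
  ultimately show ?thesis using that by blast
qed

section \<open>Reduction to finitely many lists of cluster sizes\<close>

theorem lemma25:
  fixes I :: "('s, 't) flamecast" and t :: 't and z :: point and r :: real
  assumes "flamecast_instance I"
    and "sinks I = {t}"
    and "intermediate_layers I = 1"
    and "circular I z r"
    and "source_equally_spaced I z r"
    and "feasible I"
  shows "\<forall>s \<in> sources I. \<forall>xs. ccw_ordering_from I z r s xs \<longrightarrow>
           (\<exists>L. min_cost_layout I L \<and> k_consecutive 1 xs L)"
proof (intro ballI allI impI)
  fix s xs assume s: "s \<in> sources I" and ccw: "ccw_ordering_from I z r s xs"
  let ?S = "sources I"
  have fin: "finite ?S" and ne: "?S \<noteq> {}" and "r > 0"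
    and t: "t \<in> sinks I" "sink_pos I t = z"
    using assms s by (auto simp: flamecast_instance_def circular_def)
  have xs: "distinct xs" "set xs = ?S"
    using ccw by (auto simp: ccw_ordering_from_def)
  have n: "length xs = card ?S"
    using xs distinct_card by metis
  have cap1: "1 \<le> caps I ! 1"
    using assms(1) by (auto simp: flamecast_instance_def)
  obtain \<theta> where pos: "\<And>i. i < length xs \<Longrightarrow>
      source_pos I (xs ! i) = circle_point z r (\<theta> + 2 * pi * real i / real (length xs))"
    by (rule ccw_ordering_positions[OF \<open>r > 0\<close> assms(5) ccw]) blast
  have arc: "\<exists>p'. cluster_cost I z (set ys) p' \<le> cluster_cost I z G p"
    if "G \<subseteq> ?S" "sublist ys xs" "length ys = card G" for G ys p
    by (rule consecutive_cluster_optimal[OF \<open>r > 0\<close> xs(1) pos]) (use that xs(2) in auto)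

  \<comment> \<open>The prefix of length \<open>k\<close> represents all clusters of size
    \<open>k\<close>. The guard keeps it nonempty, as the existence of an optimal hub
    requires.\<close>
  have "\<exists>p. \<forall>p'. k > 0 \<longrightarrow> cluster_cost I z (set (take k xs)) p \<le> cluster_cost I z (set (take k xs)) p'" for k
  proof (cases "k > 0")
    case True
    then have "set (take k xs) \<noteq> {}" using xs(2) ne by auto
    then show ?thesis
      using cluster_cost_attains_min[of "set (take k xs)" I z] by blast
  qed simp
  then obtain q where q: "\<And>k p'. k > 0 \<Longrightarrow>
      cluster_cost I z (set (take k xs)) (q k) \<le> cluster_cost I z (set (take k xs)) p'"
    by metis
  \<comment> \<open>By rotational symmetry \<open>g k\<close> is the least cost of any cluster of \<open>k\<close> sources.\<close>
  define g where "g = (\<lambda>k. cluster_cost I z (set (take k xs)) (q k))"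
  have g_le: "g (card G) \<le> cluster_cost I z G p" if "G \<subseteq> ?S" "G \<noteq> {}" for G p
  proof -
    have "finite G" using that(1) fin finite_subset by blast
    then have "card G > 0" "card G \<le> length xs"
      using that n card_mono[OF fin that(1)] by (auto simp: card_gt_0_iff)
    then show ?thesis
      using arc[OF that(1) sublist_take, of "card G" p] q[of "card G"]
      unfolding g_def by (fastforce intro: order_trans)
  qed
  \<comment> \<open>Conversely, every block of consecutive sources attains this value, by comparing
    it with the prefix of the same length.\<close>
  have g_ge: "\<exists>p. cluster_cost I z (set ys) p \<le> g (length ys)" if ys: "sublist ys xs" for ys
  proof -
    have "length ys \<le> length xs" using ys by (rule sublist_length_le)
    then have "card (set (take (length ys) xs)) = length ys"
      using xs(1) by (simp add: distinct_card)
    then show ?thesis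
      unfolding g_def using arc[OF _ ys] set_take_subset xs(2) by metis
  qed

  \<comment> \<open>The admissible lists of cluster sizes. Positive entries bound their length by
    their sum, which makes \<open>K\<close> finite.\<close>
  define K where "K = {ks. sum_list ks = length xs \<and> (\<forall>k\<in>set ks. 0 < k \<and> k \<le> caps I ! 1)}"
  have "finite K"
  proof (rule finite_subset)
    show "K \<subseteq> {ks. set ks \<subseteq> {..length xs} \<and> length ks \<le> length xs}"
    proof (clarify, intro conjI subsetI)
      fix ks assume "ks \<in> K"
      then have ks: "sum_list ks = length xs" "\<forall>k\<in>set ks. 0 < k" by (auto simp: K_def)
      show "k \<in> {..length xs}" if "k \<in> set ks" for k
        using member_le_sum_list[OF that] ks(1) by simp
      have "(\<Sum>k\<leftarrow>ks. 1) \<le> (\<Sum>k\<leftarrow>ks. k)"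
        using ks(2) by (intro sum_list_mono) auto
      then show "length ks \<le> length xs"
        using ks(1) by (simp add: sum_list_triv)
    qed
  qed (rule finite_lists_length_le, simp)

  \<comment> \<open>Each valid layout yields a list of sizes in \<open>K\<close> that bounds its
    cost from below. The bound on \<open>card ?S\<close> is recorded too, so that feasibility
    supplies the sink's capacity for the new layout.\<close>
  have lower: "card ?S \<le> caps I ! 0 \<and> (\<exists>ks\<in>K. (\<Sum>k\<leftarrow>ks. g k) \<le> cost I L)" if L: "valid_layout I L" for L
  proof -
    have lay: "is_topology I (verts L) (edges L)" and emb: "is_embedding I (pos L)"
      using L by (auto simp: valid_layout_def is_layout_def)
    obtain f where f: "parent_map ?S t f" "verts L = star_verts ?S t f" "edges L = star_edges ?S t f"
      by (rule topology_is_star[OF lay assms(2,3) ne])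
    have caps: "\<And>m. card {s \<in> ?S. f s = Steiner m} \<le> caps I ! 1" "card ?S \<le> caps I ! 0"
      using L valid_layout_star_iff[OF assms(1-3) ne f(1) emb f(2,3)] by auto
    define A where "A = (\<lambda>s. if f s = Sink t then Source s else f s)"
    define fib where "fib = (\<lambda>b. {s \<in> ?S. A s = b})"
    define h where "h = (\<lambda>b :: ('s, 't) vertex. if b \<in> range Steiner then pos L b else z)"
    have cost: "cost I L = (\<Sum>b\<in>A ` ?S. cluster_cost I z (fib b) (h b))"
      unfolding A_def fib_def h_def by (rule cost_star[OF fin f(1,3) emb t])
    obtain bs where bs: "set bs = A ` ?S" "distinct bs"
      using finite_distinct_list[of "A ` ?S"] fin by blast
    define ks where "ks = map (\<lambda>b. card (fib b)) bs"
    have fib_ne: "fib b \<subseteq> ?S" "fib b \<noteq> {}" if "b \<in> A ` ?S" for b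
      using that by (auto simp: fib_def)
    have fib_cap: "card (fib b) \<le> caps I ! 1" if b: "b \<in> A ` ?S" for b
    proof -
      obtain s where s: "s \<in> ?S" "b = A s" using b by blast
      from parent_map_cases[OF f(1) s(1)] show ?thesis
      proof cases
        case 1
        \<comment> \<open>A source attached directly to the sink forms a cluster of its own, whose
          size fits because capacities are at least 1.\<close>
        have "fib b \<subseteq> {s}"
        proof
          fix x assume "x \<in> fib b"
          then have x: "x \<in> ?S" "A x = Source s"
            using s 1 by (auto simp: fib_def A_def)
          from parent_map_cases[OF f(1) x(1)] show "x \<in> {s}"
            using x(2) by cases (simp_all add: A_def)
        qed
        then have "card (fib b) \<le> 1"
          using card_mono[of "{s}" "fib b"] by simp
        then show ?thesis using cap1 by linarith
      next
        case (2 m)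
        have "fib b = {s \<in> ?S. f s = Steiner m}"
          using s 2 by (auto simp: fib_def A_def split: if_splits)
        then show ?thesis using caps(1) by simp
      qed
    qed
    have "sum_list ks = (\<Sum>b\<in>A ` ?S. card (fib b))"
      using bs by (simp add: ks_def sum_list_distinct_conv_sum_set)
    also have "\<dots> = card ?S"
      using sum.image_gen[OF fin, of "\<lambda>_. 1::nat" A] by (simp add: fib_def)
    finally have "sum_list ks = length xs" using n by simp
    moreover have "\<forall>k\<in>set ks. 0 < k \<and> k \<le> caps I ! 1"
      using fib_cap fib_ne fin bs(1) finite_subset[OF fib_ne(1) fin]
      by (auto simp: ks_def card_gt_0_iff)
    ultimately have "ks \<in> K" by (simp add: K_def)
    moreover have "(\<Sum>k\<leftarrow>ks. g k) \<le> cost I L"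
    proof -
      have "(\<Sum>k\<leftarrow>ks. g k) = (\<Sum>b\<in>A ` ?S. g (card (fib b)))"
        using bs by (simp add: ks_def sum_list_distinct_conv_sum_set o_def)
      also have "\<dots> \<le> cost I L"
        unfolding cost by (intro sum_mono g_le fib_ne)
      finally show ?thesis .
    qed
    ultimately show ?thesis using caps(2) by blast
  qed
  obtain L0 where "valid_layout I L0"
    using assms(6) by (auto simp: feasible_def)
  then have cap0: "card ?S \<le> caps I ! 0" and "K \<noteq> {}"
    using lower by blast+
  then obtain ks where ks: "ks \<in> K" "\<And>ks'. ks' \<in> K \<Longrightarrow> (\<Sum>k\<leftarrow>ks. g k) \<le> (\<Sum>k\<leftarrow>ks'. g k)"
    using ex_is_arg_min_if_finite[OF \<open>finite K\<close>, of "\<lambda>ks. \<Sum>k\<leftarrow>ks. g k"]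
    by (auto simp: is_arg_min_linorder)
  have ks': "sum_list ks = length xs" "\<forall>k\<in>set ks. 0 < k" "\<And>m. m < length ks \<Longrightarrow> ks ! m \<le> caps I ! 1"
    using ks(1) by (auto simp: K_def)
  obtain A where A: "A ` set xs = {..<length ks}"
    "\<And>m. m < length ks \<Longrightarrow> \<exists>ys. sublist ys xs \<and> length ys = ks ! m \<and> {s \<in> set xs. A s = m} = set ys"
    by (rule consecutive_clustering[OF xs(1) ks'(1,2)]) blast
  obtain ys where ys: "\<And>m. m < length ks \<Longrightarrow> sublist (ys m) xs"
    "\<And>m. m < length ks \<Longrightarrow> length (ys m) = ks ! m"
    "\<And>m. m < length ks \<Longrightarrow> {s \<in> ?S. A s = m} = set (ys m)"
  proof -
    have "\<forall>m. \<exists>ys. m < length ks \<longrightarrow>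
        sublist ys xs \<and> length ys = ks ! m \<and> {s \<in> ?S. A s = m} = set ys"
      using A(2) unfolding xs(2) by blast
    from choice[OF this] show ?thesis using that by blast
  qed
  obtain p where p: "\<And>m. m < length ks \<Longrightarrow> cluster_cost I z (set (ys m)) (p m) \<le> g (ks ! m)"
  proof -
    have "\<forall>m. \<exists>p. m < length ks \<longrightarrow> cluster_cost I z (set (ys m)) p \<le> g (ks ! m)"
      using g_ge[OF ys(1)] by (auto simp: ys(2))
    from choice[OF this] show ?thesis using that by blast
  qed

  \<comment> \<open>Every block, even a single source, receives its own Steiner vertex. Compared
    with a direct edge to the sink this costs no more, since the hub may also lie at
    \<open>z\<close>.\<close>
  define f :: "'s \<Rightarrow> ('s, 't) vertex" where "f = (\<lambda>s. Steiner (A s))"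
  define L :: "('s, 't) layout" where
    "L = \<lparr>verts = star_verts ?S t f, edges = star_edges ?S t f,
      pos = (\<lambda>v. case v of Source s \<Rightarrow> source_pos I s | Sink t \<Rightarrow> sink_pos I t | Steiner m \<Rightarrow> p m)\<rparr>"
  have L: "verts L = star_verts ?S t f" "edges L = star_edges ?S t f"
    and pos_Steiner: "\<And>m. pos L (Steiner m) = p m"
    and emb: "is_embedding I (pos L)"
    by (auto simp: L_def is_embedding_def)
  have pm: "parent_map ?S t f"
    by (auto simp: parent_map_def f_def)
  have children: "children (edges L) (Steiner m) = Source ` {s \<in> ?S. A s = m}" for m
    by (auto simp: children_def L star_edges_def f_def)
  have "card {s \<in> ?S. f s = Steiner m} \<le> caps I ! 1" for m
  proof (cases "m < length ks")
    case True
    then have "{s \<in> ?S. f s = Steiner m} = set (ys m)"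
      using ys(3) by (simp add: f_def)
    then show ?thesis
      using card_length[of "ys m"] ys(2) ks'(3) True by (metis order_trans)
  next
    case False
    then have "{s \<in> ?S. f s = Steiner m} = {}"
      using A(1) xs(2) by (auto simp: f_def)
    then show ?thesis by (metis card.empty le0)
  qed
  then have valid: "valid_layout I L"
    using valid_layout_star_iff[OF assms(1-3) ne pm emb L] cap0 by blast
  have cost: "cost I L \<le> (\<Sum>k\<leftarrow>ks. g k)"
  proof -
    have "cost I L = (\<Sum>b\<in>f ` ?S. cluster_cost I z {s \<in> ?S. f s = b} (if b \<in> range Steiner then pos L b else z))"
      using cost_star[OF fin pm L(2) emb t] by (simp add: f_def)
    also have "f ` ?S = Steiner ` {..<length ks}"
      using A(1) xs(2) by (auto simp: f_def)
    also have "(\<Sum>b\<in>Steiner ` {..<length ks}. cluster_cost I z {s \<in> ?S. f s = b}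
          (if b \<in> range Steiner then pos L b else z))
        = (\<Sum>m<length ks. cluster_cost I z (set (ys m)) (p m))"
      by (subst sum.reindex) (auto simp: inj_on_def f_def pos_Steiner ys(3) intro!: sum.cong)
    also have "\<dots> \<le> (\<Sum>m<length ks. g (ks ! m))"
      using p by (intro sum_mono) auto
    also have "\<dots> = (\<Sum>k\<leftarrow>ks. g k)"
      by (simp add: sum_list_sum_nth atLeast0LessThan)
    finally show ?thesis .
  qed
  have "min_cost_layout I L"
    unfolding min_cost_layout_def
  proof (intro conjI allI impI)
    fix L' assume "valid_layout I L'"
    then obtain ks' where "ks' \<in> K" "(\<Sum>k\<leftarrow>ks'. g k) \<le> cost I L'"
      using lower by blast
    then show "cost I L \<le> cost I L'"
      using cost ks(2) by (meson order_trans)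
  qed (rule valid)
  moreover have "k_consecutive 1 xs L"
    unfolding k_consecutive_def
  proof
    fix v assume "v \<in> verts L \<inter> range Steiner"
    then obtain m where m: "v = Steiner m" "Steiner m \<in> f ` ?S"
      by (auto simp: L star_verts_def)
    then have mlen: "m < length ks"
      using A(1) xs(2) by (auto simp: f_def)
    have "children (edges L) v = Source ` set (ys m)"
      using children ys(3)[OF mlen] m(1) by simp
    \<comment> \<open>The witness is the partition with a single part, and parts of a partition must
      be nonempty.\<close>
    moreover have "set (ys m) \<noteq> {}"
      using ys(3)[OF mlen] m(2) by (auto simp: f_def)
    ultimately show "k_consecutive_vertex 1 xs (edges L) v"
      unfolding k_consecutive_vertex_def using ys(1)[OF mlen]
      by (intro exI[of _ "{Source ` set (ys m)}"]) (auto simp: partition_on_def)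
  qed
  ultimately show "\<exists>L. min_cost_layout I L \<and> k_consecutive 1 xs L" by blast
qed

end
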